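(* Let $\langle D;<\rangle$ be a (strict) linear order. Then $\langle D;<\rangle$ satisfies the scheme $\mathtt{DCI}$ if and only if it satisfies the scheme $\mathtt{DCI}_2$.
   Context: All formulas are first-order formulas in the language $\{<\}$; a scheme "holds" in a structure if every instance (with any further free variables of $\varphi$ read universally, i.e. as parameters) is true in it. The scheme $\mathtt{DCI}$ consists of all sentences $$\exists x\,\forall y\!<\!x\,\varphi(y)\;\wedge\;\forall x\big[\forall y\!<\!x\,\varphi(y)\rightarrow\exists z\!>\!x\,\forall y\!<\!z\,\varphi(y)\big]\longrightarrow\forall x\,\varphi(x),$$ for arbitrary formulas $\varphi$. The scheme $\mathtt{DCI}_2$ consists of all sentences $$\exists x\,\forall y\!\leqslant\!x\,\varphi(y)\;\wedge\;\forall x\big[\forall y\!\leqslant\!x\,\varphi(y)\rightarrow\exists z\!>\!x\,\forall y\!<\!z\,\varphi(y)\big]\;\wedge\;\forall x\big[\forall y\!<\!x\,\varphi(y)\rightarrow\varphi(x)\big]\longrightarrow\forall x\,\varphi(x),$$ for arbitrary formulas $\varphi$. *)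

theory Defs
  imports Main
begin

(* First-order formulas over the signature {<} with equality, in de Bruijn style:
   variable 0 refers to the innermost enclosing quantifier, and an index exceeding the
   number of enclosing quantifiers is a free variable. *)
datatype fm =
    Eq nat nat
  | Lt nat nat
  | Neg fm
  | Conj fm fm
  | Disj fm fm
  | Imp fm fm
  | Forall fm
  | Exists fm

(* The structure has universe D, and (a, b) \<in> r interprets a < b. *)
primrec sat :: "'a set \<Rightarrow> 'a rel \<Rightarrow> (nat \<Rightarrow> 'a) \<Rightarrow> fm \<Rightarrow> bool" where
  "sat D r e (Eq i j) \<longleftrightarrow> e i = e j"
| "sat D r e (Lt i j) \<longleftrightarrow> (e i, e j) \<in> r"
| "sat D r e (Neg p) \<longleftrightarrow> \<not> sat D r e p"
| "sat D r e (Conj p q) \<longleftrightarrow> sat D r e p \<and> sat D r e q"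
| "sat D r e (Disj p q) \<longleftrightarrow> sat D r e p \<or> sat D r e q"
| "sat D r e (Imp p q) \<longleftrightarrow> (sat D r e p \<longrightarrow> sat D r e q)"
| "sat D r e (Forall p) \<longleftrightarrow> (\<forall>a\<in>D. sat D r (case_nat a e) p)"
| "sat D r e (Exists p) \<longleftrightarrow> (\<exists>a\<in>D. sat D r (case_nat a e) p)"

(* Free variables of the axioms are parameters, i.e. they are read universally over D. *)
definition models :: "'a set \<Rightarrow> 'a rel \<Rightarrow> fm set \<Rightarrow> bool" where
  "models D r T \<longleftrightarrow> (\<forall>p\<in>T. \<forall>e. range e \<subseteq> D \<longrightarrow> sat D r e p)"

(* Simultaneous renaming of the free variables; it cannot capture, since the renaming is
   lifted when passing under a quantifier. *)
primrec rename :: "(nat \<Rightarrow> nat) \<Rightarrow> fm \<Rightarrow> fm" where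
  "rename f (Eq i j) = Eq (f i) (f j)"
| "rename f (Lt i j) = Lt (f i) (f j)"
| "rename f (Neg p) = Neg (rename f p)"
| "rename f (Conj p q) = Conj (rename f p) (rename f q)"
| "rename f (Disj p q) = Disj (rename f p) (rename f q)"
| "rename f (Imp p q) = Imp (rename f p) (rename f q)"
| "rename f (Forall p) = Forall (rename (case_nat 0 (\<lambda>i. Suc (f i))) p)"
| "rename f (Exists p) = Exists (rename (case_nat 0 (\<lambda>i. Suc (f i))) p)"

(* In a scheme, variable 0 of the formula p is the displayed argument of p, and the
   variables 1, 2, ... are its parameters. Under k quantifiers of the scheme,
   app_var k v p is p(v): the argument becomes the variable v and the
   parameters are shifted past the k quantified variables. *)
definition app_var :: "nat \<Rightarrow> nat \<Rightarrow> fm \<Rightarrow> fm" where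
  "app_var k v p = rename (case_nat v (\<lambda>i. i + k)) p"

definition Le :: "nat \<Rightarrow> nat \<Rightarrow> fm" where
  "Le i j = Disj (Lt i j) (Eq i j)"

(* Bounded quantifiers. The bound v is a variable of the context outside the quantifier,
   hence Suc v inside; the body p is read inside the quantifier. *)
definition Forall_lt :: "nat \<Rightarrow> fm \<Rightarrow> fm" where
  "Forall_lt v p = Forall (Imp (Lt 0 (Suc v)) p)"

definition Forall_le :: "nat \<Rightarrow> fm \<Rightarrow> fm" where
  "Forall_le v p = Forall (Imp (Le 0 (Suc v)) p)"

definition Exists_gt :: "nat \<Rightarrow> fm \<Rightarrow> fm" where
  "Exists_gt v p = Exists (Conj (Lt (Suc v) 0) p)"

definition DCI_instance :: "fm \<Rightarrow> fm" where
  "DCI_instance p =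
     Imp (Conj (Exists (Forall_lt 0 (app_var 2 0 p)))
               (Forall (Imp (Forall_lt 0 (app_var 2 0 p))
                            (Exists_gt 0 (Forall_lt 0 (app_var 3 0 p))))))
         (Forall (app_var 1 0 p))"

definition DCI2_instance :: "fm \<Rightarrow> fm" where
  "DCI2_instance p =
     Imp (Conj (Exists (Forall_le 0 (app_var 2 0 p)))
         (Conj (Forall (Imp (Forall_le 0 (app_var 2 0 p))
                            (Exists_gt 0 (Forall_lt 0 (app_var 3 0 p)))))
               (Forall (Imp (Forall_lt 0 (app_var 2 0 p))
                            (app_var 1 0 p)))))
         (Forall (app_var 1 0 p))"

definition DCI :: "fm set" where
  "DCI = range DCI_instance"

definition DCI2 :: "fm set" where
  "DCI2 = range DCI2_instance"

end

theory Submission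
  imports Defs
begin

(* If \<phi> is progressive in the sense of either scheme, then holding below x already forces
   \<phi>(x): in DCI because the witness z > x has x below it, in DCI2 by the third premise.
   So for the same \<phi> and parameters the premises of the two schemes are equivalent. *)

text \<open>Supplies the quantifier cases of \<open>sat_rename\<close>: the lifted renaming fixes
  the newly bound variable, and its shift by \<open>Suc\<close> skips the value \<open>a\<close>
  just pushed.\<close>

lemma case_nat_comp_lift:
  "(\<lambda>j. case_nat a e (case_nat 0 (\<lambda>i. Suc (f i)) j)) = case_nat a (\<lambda>i. e (f i))"
  by (auto simp: fun_eq_iff split: nat.split)

lemma sat_rename: "sat D r e (rename f p) \<longleftrightarrow> sat D r (\<lambda>i. e (f i)) p"
  \<comment> \<open>Both \<open>e\<close> and \<open>f\<close> change under a quantifier, so the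
    induction hypothesis must cover all of them.\<close>
  by (induction p arbitrary: e f) (simp_all add: case_nat_comp_lift)

lemma sat_app_var: "sat D r e (app_var k v p) \<longleftrightarrow> sat D r (case_nat (e v) (\<lambda>i. e (i + k))) p"
proof -
  have "(\<lambda>j. e (case_nat v (\<lambda>i. i + k) j)) = case_nat (e v) (\<lambda>i. e (i + k))"
    by (auto simp: fun_eq_iff split: nat.split)
  then show ?thesis
    by (simp add: app_var_def sat_rename)
qed

text \<open>The shift in \<open>app_var\<close> cancels the values pushed by the scheme's
  quantifiers, so every copy of \<open>p\<close> sees the same parameters \<open>e\<close> and all
  copies denote one predicate \<phi>.\<close>

lemma sat_DCI_instance:
  "sat D r e (DCI_instance p) \<longleftrightarrow>
    (let \<phi> = (\<lambda>a. sat D r (case_nat a e) p) in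
      (\<exists>x\<in>D. \<forall>y\<in>D. (y, x) \<in> r \<longrightarrow> \<phi> y) \<and>
      (\<forall>x\<in>D. (\<forall>y\<in>D. (y, x) \<in> r \<longrightarrow> \<phi> y) \<longrightarrow>
        (\<exists>z\<in>D. (x, z) \<in> r \<and> (\<forall>y\<in>D. (y, z) \<in> r \<longrightarrow> \<phi> y))) \<longrightarrow>
      (\<forall>x\<in>D. \<phi> x))"
  \<comment> \<open>Writing 2 and 3 with \<open>Suc\<close> lets \<open>case_nat\<close> compute at
    the shifted indices.\<close>
  by (simp add: DCI_instance_def Forall_lt_def Exists_gt_def sat_app_var
      numeral_2_eq_2 numeral_3_eq_3)

lemma sat_DCI2_instance:
  "sat D r e (DCI2_instance p) \<longleftrightarrow>
    (let \<phi> = (\<lambda>a. sat D r (case_nat a e) p) in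
      (\<exists>x\<in>D. \<forall>y\<in>D. (y, x) \<in> r \<or> y = x \<longrightarrow> \<phi> y) \<and>
      (\<forall>x\<in>D. (\<forall>y\<in>D. (y, x) \<in> r \<or> y = x \<longrightarrow> \<phi> y) \<longrightarrow>
        (\<exists>z\<in>D. (x, z) \<in> r \<and> (\<forall>y\<in>D. (y, z) \<in> r \<longrightarrow> \<phi> y))) \<and>
      (\<forall>x\<in>D. (\<forall>y\<in>D. (y, x) \<in> r \<longrightarrow> \<phi> y) \<longrightarrow> \<phi> x) \<longrightarrow>
      (\<forall>x\<in>D. \<phi> x))"
  by (simp add: DCI2_instance_def Forall_lt_def Forall_le_def Le_def Exists_gt_def sat_app_var
      numeral_2_eq_2 numeral_3_eq_3)

lemma DCI_premises_iff_DCI2_premises: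
  "(\<exists>x\<in>D. \<forall>y\<in>D. (y, x) \<in> r \<longrightarrow> \<phi> y) \<and>
   (\<forall>x\<in>D. (\<forall>y\<in>D. (y, x) \<in> r \<longrightarrow> \<phi> y) \<longrightarrow>
     (\<exists>z\<in>D. (x, z) \<in> r \<and> (\<forall>y\<in>D. (y, z) \<in> r \<longrightarrow> \<phi> y)))
   \<longleftrightarrow>
   (\<exists>x\<in>D. \<forall>y\<in>D. (y, x) \<in> r \<or> y = x \<longrightarrow> \<phi> y) \<and>
   (\<forall>x\<in>D. (\<forall>y\<in>D. (y, x) \<in> r \<or> y = x \<longrightarrow> \<phi> y) \<longrightarrow>
     (\<exists>z\<in>D. (x, z) \<in> r \<and> (\<forall>y\<in>D. (y, z) \<in> r \<longrightarrow> \<phi> y))) \<and>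
   (\<forall>x\<in>D. (\<forall>y\<in>D. (y, x) \<in> r \<longrightarrow> \<phi> y) \<longrightarrow> \<phi> x)"
  (is "?ex \<and> ?step \<longleftrightarrow> ?ex2 \<and> ?step2 \<and> ?prog")
proof -
  \<comment> \<open>\<open>?prog\<close> supplies the one missing case \<open>y = x\<close>.\<close>
  have closed_iff: "(\<forall>y\<in>D. (y, x) \<in> r \<or> y = x \<longrightarrow> \<phi> y) \<longleftrightarrow> (\<forall>y\<in>D. (y, x) \<in> r \<longrightarrow> \<phi> y)"
    if ?prog "x \<in> D" for x
    using that by blast
  have "?prog" if ?step
  proof (intro ballI impI)
    fix x assume "x \<in> D" "\<forall>y\<in>D. (y, x) \<in> r \<longrightarrow> \<phi> y"
    \<comment> \<open>The witness \<open>z\<close> lies above \<open>x\<close>, so \<open>x\<close>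
      itself is among the points below \<open>z\<close>.\<close>
    with that obtain z where "(x, z) \<in> r" "\<forall>y\<in>D. (y, z) \<in> r \<longrightarrow> \<phi> y"
      by blast
    with \<open>x \<in> D\<close> show "\<phi> x"
      by blast
  qed
  moreover have "?ex \<longleftrightarrow> ?ex2" if ?prog
    by (intro bex_cong refl) (simp only: closed_iff[OF that])
  \<comment> \<open>The two differ only in the antecedent, which \<open>closed_iff\<close>
    identifies.\<close>
  moreover have "?step \<longleftrightarrow> ?step2" if ?prog
    by (intro ball_cong refl) (simp only: closed_iff[OF that])
  \<comment> \<open>Each side yields \<open>?prog\<close>: the left through \<open>?step\<close>,
    the right as a conjunct. The rest is propositional.\<close>
  ultimately show ?thesis
    by argo
qed

lemma sat_DCI_instance_iff_DCI2_instance: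
  "sat D r e (DCI_instance p) \<longleftrightarrow> sat D r e (DCI2_instance p)"
  unfolding sat_DCI_instance sat_DCI2_instance Let_def DCI_premises_iff_DCI2_premises ..

theorem theorem2p7:
  fixes D :: "'a set" and r :: "'a rel"
  assumes "r \<subseteq> D \<times> D"
    and "strict_linear_order_on D r"
  shows "models D r DCI \<longleftrightarrow> models D r DCI2"
  \<comment> \<open>Both schemes range over the same formulas, so instances are matched formula by
    formula under each environment.\<close>
  by (simp add: models_def DCI_def DCI2_def sat_DCI_instance_iff_DCI2_instance)

end
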